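(* Let $N\ge K\ge1$, $\mathbf{H}\in\mathbb{R}^{N\times K}$ full column rank, with orthonormal eigenvectors $\mathbf{u}_1,\ldots,\mathbf{u}_N$ of $\mathbf{H}\mathbf{H}^T$, $\mathbf{H}\mathbf{H}^T\mathbf{u}_i=\rho_i^2\mathbf{u}_i$, $\rho_1^2\ge\cdots\ge\rho_N^2\ge0$, $\rho_1^2>\rho_N^2$. Let $M_1,M_2$ be positive integers, $M=M_1+M_2$, and use the measurement matrix $\boldsymbol{\Phi}=[\boldsymbol{\Phi}_s^T,\boldsymbol{\Phi}_o^T]^T$ with $\boldsymbol{\Phi}_s=\frac{1}{\sqrt M}\mathbf{1}_{M_1,1}\otimes\mathbf{u}_1^T$ and $\boldsymbol{\Phi}_o=\frac{1}{\sqrt M}\mathbf{1}_{M_2,1}\otimes\mathbf{u}_N^T$. Define $\bar z_s[n]=\frac{1}{M_1}\mathbf{1}_{1,M_1}\mathbf{z}_s[n]$ and $\bar z_o[n]=\frac{1}{M_2}\mathbf{1}_{1,M_2}\mathbf{z}_o[n]$, and for $\gamma>0$ consider the test deciding $\mathcal{H}_1$ when $$\mathcal{T}=\frac{M_1\sum_{n=1}^{N_b}|\bar z_s[n]|^2}{M_2\sum_{n=1}^{N_b}|\bar z_o[n]|^2}>\gamma.$$ Then $P_{FA}=\mathbb{Q}_{F(N_b,N_b)}(\gamma)$ and $$P_D=\mathbb{Q}_{F(N_b,N_b)}\Big(\frac{\sigma_0^2+M_2\sigma_x^2\rho_N^2}{\sigma_0^2+M_1\sigma_x^2\rho_1^2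}\gamma\Big).$$
   Context: Observations over $n=1,\ldots,N_b$: rows $\boldsymbol{\phi}_m^T$ of $\boldsymbol{\Phi}$ represent $M$ devices; under $\mathcal{H}_0$ device $m$ outputs $z_m[n]=\boldsymbol{\phi}_m^T\mathbf{w}_m[n]$, and under $\mathcal{H}_1$ it outputs $z_m[n]=\boldsymbol{\phi}_m^T(\mathbf{H}\mathbf{x}[n]+\mathbf{w}_m[n])$, where $\mathbf{x}[n]\sim\mathcal{N}(\mathbf{0}_{K,1},\sigma_x^2\mathbf{I}_K)$ and $\mathbf{w}_m[n]\sim\mathcal{N}(\mathbf{0}_{N,1},\sigma_0^2\mathbf{I}_N)$, $\sigma_0^2>0$, all mutually independent across $m$ and $n$. $\mathbf{z}_s[n]$ collects the outputs of the first $M_1$ devices (rows of $\boldsymbol{\Phi}_s$), $\mathbf{z}_o[n]$ those of the last $M_2$. $\mathbf{1}_{P,Q}$ is the $P\times Q$ all-ones matrix; $\otimes$ the Kronecker product. $P_{FA}=\Pr(\mathcal{T}>\gamma\mid\mathcal{H}_0)$, $P_D=\Pr(\mathcal{T}>\gamma\mid\mathcal{H}_1)$; $\mathbb{Q}_{F(d_1,d_2)}(x)=\Pr(X>x)$ for $X$ $F$-distributed with $(d_1,d_2)$ degrees of freedom. *)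

theory Defs
  imports "HOL-Probability.Probability"
begin

definition F_density :: "nat \<Rightarrow> nat \<Rightarrow> real \<Rightarrow> real" where
  "F_density d1 d2 t =
     (if t \<le> 0 then 0
      else (real d1 / real d2) powr (real d1 / 2) * t powr (real d1 / 2 - 1)
           * (1 + real d1 * t / real d2) powr (- (real d1 + real d2) / 2)
           / Beta (real d1 / 2) (real d2 / 2))"

definition Q_F :: "nat \<Rightarrow> nat \<Rightarrow> real \<Rightarrow> real" where
  "Q_F d1 d2 x = (LBINT t:{x<..}. F_density d1 d2 t)"

text \<open>Row phi_m of the measurement matrix Phi = [Phi_s; Phi_o], devices m = 1..M1+M2:
  the first M1 rows are u_1^T / sqrt M, the last M2 rows are u_N^T / sqrt M.\<close>
definition Phi_row :: "nat \<Rightarrow> nat \<Rightarrow> real^'n \<Rightarrow> real^'n \<Rightarrow> nat \<Rightarrow> real^'n" where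
  "Phi_row M1 M2 u1 uN m =
     (if m \<le> M1 then (1 / sqrt (real (M1 + M2))) *\<^sub>R u1
      else (1 / sqrt (real (M1 + M2))) *\<^sub>R uN)"

definition test_stat :: "nat \<Rightarrow> nat \<Rightarrow> nat \<Rightarrow> (nat \<Rightarrow> nat \<Rightarrow> real) \<Rightarrow> real" where
  "test_stat M1 M2 Nb z =
     (let zs = (\<lambda>n. (1 / real M1) * (\<Sum>m = 1..M1. z m n));
          zo = (\<lambda>n. (1 / real M2) * (\<Sum>m = M1 + 1..M1 + M2. z m n))
      in (real M1 * (\<Sum>n = 1..Nb. \<bar>zs n\<bar>^2)) / (real M2 * (\<Sum>n = 1..Nb. \<bar>zo n\<bar>^2)))"

end

theory Submission
  imports Defs
begin

text \<open>The numerator and denominator of the statistic are built from the sums of the outputs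
  of the two device groups. The noise of the groups is independent, and the signal enters them
  through the inner products of \<open>x n\<close> with \<open>p = H\<^sup>T u\<^sub>1\<close> and \<open>q = H\<^sup>T u\<^sub>N\<close>, which are orthogonal
  because \<open>p \<bullet> q = u\<^sub>1 \<bullet> H H\<^sup>T u\<^sub>N = \<rho>\<^sub>N\<^sup>2 (u\<^sub>1 \<bullet> u\<^sub>N) = 0\<close>. Rotational invariance of the iid
  Gaussian law makes them independent, so the group sums are independent centred Gaussians.
  Their normalised half squares are Gamma(1/2) distributed, the sums over \<open>n\<close> are
  Gamma(\<open>Nb\<close>/2), and the ratio of two independent Gamma variables follows the beta prime law,
  which for equal shape parameters \<open>Nb\<close>/2 is the F law with (\<open>Nb\<close>, \<open>Nb\<close>) degrees of freedom.
  The null hypothesis is the special case \<open>p = q = 0\<close>.\<close>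

subsection \<open>Gamma and beta prime distributions\<close>

text \<open>Gamma law with real shape \<open>a\<close> and rate 1. Half-integer shapes are required,
  since a single square has shape 1/2; the unit rate suffices because scales are divided out
  beforehand.\<close>

definition gamma_density :: "real \<Rightarrow> real \<Rightarrow> real" where
  "gamma_density a t = (if t \<le> 0 then 0 else t powr (a - 1) * exp (- t) / Gamma a)"

lemma borel_measurable_gamma_density [measurable]:
  "gamma_density a \<in> borel_measurable borel"
  unfolding gamma_density_def [abs_def] by measurable

lemma gamma_density_nonneg: "a > 0 \<Longrightarrow> 0 \<le> gamma_density a t"
  by (simp add: gamma_density_def Gamma_real_nonneg)

text \<open>The integrand after the substitution \<open>t = y^2 / 2\<close>, whose Jacobian is
  \<open>y\<close>; the factor 2 stands for the two preimages \<open>y\<close> and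
  \<open>- y\<close>.\<close>

lemma gamma_density_square:
  fixes y :: real
  assumes "y > 0"
  shows "gamma_density (1 / 2) (y\<^sup>2 / 2) * y = 2 * std_normal_density y"
proof -
  have "(y\<^sup>2 / 2) powr (1 / 2 - 1) * y = sqrt 2"
    using assms by (simp add: powr_minus powr_half_sqrt real_sqrt_divide field_simps)
  then have "gamma_density (1 / 2) (y\<^sup>2 / 2) * y = sqrt 2 * exp (- (y\<^sup>2 / 2)) / sqrt pi"
    using assms by (simp add: gamma_density_def Gamma_one_half_real mult.commute mult.left_commute)
  also have "\<dots> = 2 * std_normal_density y"
    by (simp add: std_normal_density_def real_sqrt_mult field_simps)
  finally show ?thesis .
qed

text \<open>Evenness of the density folds the left half onto the right one; the halves overlap only
  in the null set \<open>{0}\<close>.\<close>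

lemma nn_integral_std_normal_density_symmetric:
  assumes "c \<ge> 0"
  shows "(\<integral>\<^sup>+y. ennreal (std_normal_density y) * indicator {- c..c} y \<partial>lborel)
    = (\<integral>\<^sup>+y. ennreal (2 * std_normal_density y) * indicator {0..c} y \<partial>lborel)"
proof -
  let ?f = "\<lambda>y. ennreal (std_normal_density y)"
  have reflect: "(\<integral>\<^sup>+y. ?f y * indicator {- c..0} y \<partial>lborel)
      = (\<integral>\<^sup>+y. ?f y * indicator {0..c} y \<partial>lborel)"
    by (subst nn_integral_real_affine [of _ "-1" 0])
      (auto simp: indicator_def std_normal_density_def intro!: nn_integral_cong)
  have "(\<integral>\<^sup>+y. ?f y * indicator {- c..c} y \<partial>lborel)
      = (\<integral>\<^sup>+y. ?f y * indicator {- c..0} y + ?f y * indicator {0..c} y \<partial>lborel)"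
    using assms by (intro nn_integral_cong_AE AE_I [of _ _ "{0}"]) (auto simp: indicator_def)
  also have "\<dots> = 2 * (\<integral>\<^sup>+y. ?f y * indicator {0..c} y \<partial>lborel)"
    by (subst nn_integral_add) (auto simp: reflect mult_2)
  also have "\<dots> = (\<integral>\<^sup>+y. ennreal (2 * std_normal_density y) * indicator {0..c} y \<partial>lborel)"
    by (subst nn_integral_cmult [symmetric]) (auto simp: ennreal_mult' mult_ac)
  finally show ?thesis .
qed

text \<open>Distribution functions are compared: for \<open>a \<ge> 0\<close> the event says that
  \<open>X\<close> lies in \<open>{- c..c}\<close> with \<open>c = sqrt (2 * a)\<close>, and the
  substitution \<open>t = y^2 / 2\<close> turns the gamma integral up to \<open>a\<close> into twice
  the Gaussian integral over \<open>{0..c}\<close>.\<close>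

lemma (in prob_space) distributed_half_square_std_normal:
  assumes X: "distributed M lborel X std_normal_density"
  shows "distributed M lborel (\<lambda>\<omega>. (X \<omega>)\<^sup>2 / 2) (gamma_density (1 / 2))"
proof (rule distributedI_borel_atMost [where g = "\<lambda>a. measure M {\<omega> \<in> space M. (X \<omega>)\<^sup>2 / 2 \<le> a}"])
  have [measurable]: "X \<in> borel_measurable M"
    using distributed_measurable [OF X] by simp
  show "(\<lambda>\<omega>. (X \<omega>)\<^sup>2 / 2) \<in> borel_measurable M" by measurable
  show "gamma_density (1 / 2) \<in> borel_measurable borel" by measurable
  show "AE t in lborel. 0 \<le> gamma_density (1 / 2) t" by (simp add: gamma_density_nonneg)
  show "emeasure M {\<omega> \<in> space M. (X \<omega>)\<^sup>2 / 2 \<le> a} = ennreal (measure M {\<omega> \<in> space M. (X \<omega>)\<^sup>2 / 2 \<le> a})"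
    for a by (simp add: emeasure_eq_measure)
  fix a :: real
  \<comment> \<open>The maximum covers negative \<open>a\<close>: then \<open>c = 0\<close>, the
    event is empty, and \<open>{- c..c}\<close> shrinks to a point that \<open>X\<close> hits with
    probability 0 (the fact \<open>null\<close>).\<close>
  define c where "c = sqrt (2 * max a 0)"
  have c: "c \<ge> 0" "c\<^sup>2 / 2 = max a 0" by (auto simp: c_def)
  have le_iff: "y\<^sup>2 / 2 \<le> max a 0 \<longleftrightarrow> y \<in> {- c..c}" for y :: real
  proof -
    have "y\<^sup>2 / 2 \<le> max a 0 \<longleftrightarrow> y\<^sup>2 \<le> c\<^sup>2" using c by linarith
    also have "\<dots> \<longleftrightarrow> \<bar>y\<bar> \<le> c" using c by (metis abs_le_square_iff abs_of_nonneg)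
    finally show ?thesis by auto
  qed
  have deriv: "((\<lambda>y. y\<^sup>2 / 2) has_real_derivative y) (at y)" for y :: real
    by (auto intro!: derivative_eq_intros)
  have null: "AE \<omega> in M. X \<omega> \<noteq> 0"
    using AE_lborel_singleton [of "0 :: real"] by (subst distributed_AE2 [OF X]) auto
  have "(\<integral>\<^sup>+t. ennreal (gamma_density (1 / 2) t) * indicator {..a} t \<partial>lborel)
      = (\<integral>\<^sup>+t. ennreal (gamma_density (1 / 2) t) * indicator {0\<^sup>2 / 2..c\<^sup>2 / 2} t \<partial>lborel)"
    by (intro nn_integral_cong)
      (auto simp: c indicator_def gamma_density_def split: split_max)
  also have "\<dots> = (\<integral>\<^sup>+y. ennreal (gamma_density (1 / 2) (y\<^sup>2 / 2) * y) * indicator {0..c} y \<partial>lborel)"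
    using c nn_integral_substitution [of "\<lambda>y. y\<^sup>2 / 2" 0 c "gamma_density (1 / 2)" "\<lambda>y. y"]
    by (auto intro!: continuous_intros 
        simp: deriv set_borel_measurable_def ennreal_mult'' ennreal_indicator)
  also have "\<dots> = (\<integral>\<^sup>+y. ennreal (2 * std_normal_density y) * indicator {0..c} y \<partial>lborel)"
  proof (rule nn_integral_cong_AE)
    show "AE y in lborel. ennreal (gamma_density (1 / 2) (y\<^sup>2 / 2) * y) * indicator {0..c} y
        = ennreal (2 * std_normal_density y) * indicator {0..c} y"
      using AE_lborel_singleton [of "0 :: real"]
      by eventually_elim (auto simp: indicator_def gamma_density_square)
  qed
  also have "\<dots> = (\<integral>\<^sup>+y. ennreal (std_normal_density y) * indicator {- c..c} y \<partial>lborel)"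
    by (rule nn_integral_std_normal_density_symmetric [OF c(1), symmetric])
  also have "\<dots> = emeasure M (X -` {- c..c} \<inter> space M)"
    by (rule distributed_emeasure [OF X, symmetric]) simp
  also have "\<dots> = emeasure M {\<omega> \<in> space M. (X \<omega>)\<^sup>2 / 2 \<le> a}"
  proof (rule emeasure_eq_AE)
    show "AE \<omega> in M. \<omega> \<in> X -` {- c..c} \<inter> space M \<longleftrightarrow> \<omega> \<in> {\<omega> \<in> space M. (X \<omega>)\<^sup>2 / 2 \<le> a}"
      using null
    proof eventually_elim
      fix \<omega> assume "X \<omega> \<noteq> 0"
      then have "(X \<omega>)\<^sup>2 / 2 > 0" by simp
      then show "\<omega> \<in> X -` {- c..c} \<inter> space M \<longleftrightarrow> \<omega> \<in> {\<omega> \<in> space M. (X \<omega>)\<^sup>2 / 2 \<le> a}"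
        unfolding mem_Collect_eq Int_iff vimage_eq le_iff [symmetric] by linarith
    qed
  qed measurable
  also have "\<dots> = ennreal (measure M {\<omega> \<in> space M. (X \<omega>)\<^sup>2 / 2 \<le> a})"
    by (simp add: emeasure_eq_measure)
  finally show "(\<integral>\<^sup>+t. ennreal (gamma_density (1 / 2) t * indicator {..a} t) \<partial>lborel)
      = ennreal (measure M {\<omega> \<in> space M. (X \<omega>)\<^sup>2 / 2 \<le> a})"
    by (simp add: ennreal_mult'' ennreal_indicator)
qed

lemma nn_integral_Beta:
  fixes a b :: real
  assumes "a > 0" "b > 0"
  shows "(\<integral>\<^sup>+s. indicator {0..1} s * (s powr (a - 1) * (1 - s) powr (b - 1)) \<partial>lborel) = Beta a b"
  using assms by (intro nn_integral_has_integral_lebesgue has_integral_Beta_real) auto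

text \<open>With \<open>y = t * s\<close> the exponentials merge into \<open>exp (- t)\<close>, free
  of \<open>s\<close>, and a Beta integral in \<open>s\<close> remains; its value converts the two
  normalising constants into that of shape \<open>a + b\<close>.\<close>

lemma convolution_gamma_density:
  assumes a: "a > 0" and b: "b > 0"
  shows "(\<integral>\<^sup>+y. ennreal (gamma_density a (t - y)) * ennreal (gamma_density b y) \<partial>lborel)
    = gamma_density (a + b) t"
proof (cases "t \<le> 0")
  case True
  then have "(\<integral>\<^sup>+y. ennreal (gamma_density a (t - y)) * ennreal (gamma_density b y) \<partial>lborel) = (\<integral>\<^sup>+(y::real). 0 \<partial>lborel)"
    by (intro nn_integral_cong) (auto simp: gamma_density_def)
  then show ?thesis using True by (simp add: gamma_density_def)
next
  case False
  \<comment> \<open>\<open>C\<close> collects all that does not depend on \<open>s\<close>. Its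
    exponent of \<open>t\<close> is one short of \<open>a + b - 1\<close>; the Jacobian
    \<open>t\<close> supplies the missing power.\<close>
  define C where "C = t powr (a + b - 2) * exp (- t) / (Gamma a * Gamma b)"
  have C: "C \<ge> 0" using a b by (simp add: C_def Gamma_real_nonneg)
  have prod: "gamma_density a (t - t * s) * gamma_density b (t * s)
      = C * (s powr (b - 1) * (1 - s) powr (a - 1))" if "0 < s" "s < 1" for s
  proof -
    have "(t - t * s) powr (a - 1) = t powr (a - 1) * (1 - s) powr (a - 1)"
      using False that by (subst powr_mult [symmetric]) (auto simp: algebra_simps)
    moreover have "(t * s) powr (b - 1) = t powr (b - 1) * s powr (b - 1)"
      using False that by (subst powr_mult [symmetric]) auto
    moreover have "t powr (a + b - 2) = t powr (a - 1) * t powr (b - 1)"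
      by (simp add: powr_add [symmetric])
    moreover have "exp (- t) = exp (- (t - t * s)) * exp (- (t * s))"
      by (simp add: exp_add [symmetric])
    moreover have "t * s < t" using False that by simp
    ultimately show ?thesis
      using False that
      by (simp add: gamma_density_def C_def mult.commute mult.left_commute mult_le_0_iff)
  qed
  have "(\<integral>\<^sup>+y. ennreal (gamma_density a (t - y)) * ennreal (gamma_density b y) \<partial>lborel)
      = t * (\<integral>\<^sup>+s. ennreal (gamma_density a (t - t * s)) * ennreal (gamma_density b (t * s)) \<partial>lborel)"
    using False by (subst nn_integral_real_affine [where c = t and t = 0]) auto
  also have "(\<integral>\<^sup>+s. ennreal (gamma_density a (t - t * s)) * ennreal (gamma_density b (t * s)) \<partial>lborel)
      = (\<integral>\<^sup>+s. C * ennreal (indicator {0..1} s * (s powr (b - 1) * (1 - s) powr (a - 1))) \<partial>lborel)"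
  proof (intro nn_integral_cong_AE AE_I [of _ _ "{0, 1}"] subsetI)
    fix s :: real assume s: "s \<in> {s \<in> space lborel. \<not> ennreal (gamma_density a (t - t * s)) * ennreal (gamma_density b (t * s))
       = C * ennreal (indicator {0..1} s * (s powr (b - 1) * (1 - s) powr (a - 1)))}"
    show "s \<in> {0, 1}"
    proof (rule ccontr)
      assume "s \<notin> {0, 1}"
      then consider "s < 0" | "0 < s" "s < 1" | "1 < s" by force
      then show False
      proof cases
        case 1
        then have "t * s \<le> 0" using False by (simp add: mult_le_0_iff)
        then show ?thesis using s 1 by (simp add: gamma_density_def)
      next
        case 2
        then show ?thesis using s prod [OF 2] a b C
          by (simp add: ennreal_mult [symmetric] ennreal_mult' [symmetric] gamma_density_nonneg)
      next
        case 3
        then have "t - t * s \<le> 0" using False by simp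
        then show ?thesis using s 3 by (simp add: gamma_density_def)
      qed
    qed
  qed (auto simp: emeasure_lborel_countable)
  also have "\<dots> = C * ennreal (Beta b a)"
    by (subst nn_integral_cmult) (auto simp: nn_integral_Beta a b)
  finally have "(\<integral>\<^sup>+y. ennreal (gamma_density a (t - y)) * ennreal (gamma_density b y) \<partial>lborel)
      = ennreal (t * (C * Beta b a))"
    using False a b C by (simp add: ennreal_mult [symmetric] ennreal_mult' [symmetric] Beta_def Gamma_real_nonneg)
  also have "t * (C * Beta b a) = gamma_density (a + b) t"
  proof -
    have "t powr (a + b - 1) = t * t powr (a + b - 2)"
      using False by (simp add: powr_mult_base)
    moreover have "Gamma a > 0" "Gamma b > 0" using a b by (auto intro: Gamma_real_pos)
    ultimately show ?thesis
      using False by (simp add: gamma_density_def C_def Beta_def add.commute)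
  qed
  finally show ?thesis .
qed

text \<open>Adding one summand at a time convolves the densities, and the shapes add.
  \<open>I\<close> must be nonempty, as the empty sum is constant and has no density.\<close>

lemma (in prob_space) distributed_sum_gamma:
  assumes "finite I" "I \<noteq> {}" "indep_vars (\<lambda>_. borel) X I"
    and "\<And>i. i \<in> I \<Longrightarrow> a i > 0"
    and "\<And>i. i \<in> I \<Longrightarrow> distributed M lborel (X i) (gamma_density (a i))"
  shows "distributed M lborel (\<lambda>\<omega>. \<Sum>i\<in>I. X i \<omega>) (gamma_density (\<Sum>i\<in>I. a i))"
  using assms
proof (induction I rule: finite_ne_induct)
  case (singleton i)
  then show ?case by simp
next
  case (insert i I)
  have "distributed M lborel (\<lambda>\<omega>. \<Sum>i\<in>I. X i \<omega>) (gamma_density (\<Sum>i\<in>I. a i))"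
    using insert.prems by (intro insert.IH) (auto intro: indep_vars_subset)
  moreover have "indep_var borel (X i) borel (\<lambda>\<omega>. \<Sum>i\<in>I. X i \<omega>)"
    using insert by (intro indep_vars_sum) auto
  moreover have "(\<Sum>i\<in>I. a i) > 0"
    using insert by (intro sum_pos) auto
  ultimately show ?case
    using insert distributed_convolution [of "X i" "\<lambda>\<omega>. \<Sum>i\<in>I. X i \<omega>"
        "gamma_density (a i)" "gamma_density (\<Sum>i\<in>I. a i)"]
    by (simp add: convolution_gamma_density)
qed

lemma nn_integral_gamma_density:
  assumes "a > 0"
  shows "(\<integral>\<^sup>+t. gamma_density a t \<partial>lborel) = 1"
proof -
  have pos: "Gamma a > 0" using assms by (rule Gamma_real_pos)
  have "(\<integral>\<^sup>+t. gamma_density a t \<partial>lborel)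
      = (\<integral>\<^sup>+t. ennreal (1 / Gamma a) * ennreal (indicator {0..} t * t powr (a - 1) / exp t) \<partial>lborel)"
  proof (rule nn_integral_cong_AE)
    show "AE t in lborel. ennreal (gamma_density a t)
        = ennreal (1 / Gamma a) * ennreal (indicator {0..} t * t powr (a - 1) / exp t)"
      using AE_lborel_singleton [of "0 :: real"]
      by eventually_elim
        (use pos in \<open>auto simp: gamma_density_def indicator_def exp_minus field_simps ennreal_mult' [symmetric]\<close>)
  qed
  also have "\<dots> = ennreal (1 / Gamma a) * ennreal (Gamma a)"
    by (subst nn_integral_cmult) (auto simp: Gamma_conv_nn_integral_real [OF assms])
  also have "\<dots> = 1" using pos by (simp add: ennreal_mult' [symmetric])
  finally show ?thesis .
qed

section \<open>The beta prime law as the law of a ratio of gamma variables\<close>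

definition beta_prime_density :: "real \<Rightarrow> real \<Rightarrow> real \<Rightarrow> real" where
  "beta_prime_density a b r =
     (if r \<le> 0 then 0 else r powr (a - 1) * (1 + r) powr - (a + b) / Beta a b)"

lemma borel_measurable_beta_prime_density [measurable]:
  "beta_prime_density a b \<in> borel_measurable borel"
  unfolding beta_prime_density_def [abs_def] by measurable

lemma Beta_real_pos: "a > 0 \<Longrightarrow> b > 0 \<Longrightarrow> Beta a b > (0 :: real)"
  by (simp add: Beta_def Gamma_real_pos)

lemma beta_prime_density_nonneg: "a > 0 \<Longrightarrow> b > 0 \<Longrightarrow> 0 \<le> beta_prime_density a b r"
  using Beta_real_pos [of a b] by (simp add: beta_prime_density_def)

text \<open>The integral is the density at \<open>r\<close> of a ratio of independent gamma
  variables: \<open>v\<close> is the value of the denominator and the factor \<open>v\<close> the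
  Jacobian of \<open>u = v * r\<close>. The exponentials combine, so the integrand is a rescaled
  gamma density of shape \<open>a + b\<close>, whose mass is known.\<close>

lemma nn_integral_gamma_density_ratio:
  assumes a: "a > 0" and b: "b > 0" and r: "r > 0"
  shows "(\<integral>\<^sup>+v. ennreal (v * gamma_density a (v * r) * gamma_density b v) \<partial>lborel)
    = beta_prime_density a b r"
proof -
  \<comment> \<open>The power \<open>1 - (a + b)\<close> cancels the one that
    \<open>gamma_density (a + b)\<close> draws from its argument \<open>(1 + r) * v\<close>;
    integrating the rescaled density then contributes a further \<open>1 / (1 + r)\<close>.\<close>
  define C where "C = r powr (a - 1) * (1 + r) powr (1 - (a + b)) / Beta a b"
  have C: "C \<ge> 0" using Beta_real_pos [OF a b] by (simp add: C_def)
  have "v * gamma_density a (v * r) * gamma_density b v = C * gamma_density (a + b) ((1 + r) * v)"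
    for v
  proof (cases "v > 0")
    case True
    have "(v * r) powr (a - 1) = v powr (a - 1) * r powr (a - 1)"
      using r True by (subst powr_mult) auto
    moreover have "v * (v powr (a - 1) * v powr (b - 1)) = v powr (a + b - 1)"
      using True by (simp add: powr_add [symmetric] powr_mult_base)
    moreover have "(1 + r) powr (1 - (a + b)) * ((1 + r) * v) powr (a + b - 1) = v powr (a + b - 1)"
      using r True by (simp add: powr_mult mult.assoc [symmetric] powr_add [symmetric])
    moreover have "exp (- ((1 + r) * v)) = exp (- (v * r)) * exp (- v)"
      by (simp add: exp_add [symmetric] algebra_simps)
    moreover have "Gamma a > 0" "Gamma b > 0" "Gamma (a + b) > 0"
      using a b by (auto intro: Gamma_real_pos)
    moreover have "v * r > 0" "(1 + r) * v > 0" using r True by auto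
    ultimately show ?thesis
      using True
      by (simp add: gamma_density_def C_def Beta_def not_le divide_simps)
  next
    case False
    then have "(1 + r) * v \<le> 0" using r by (simp add: mult_le_0_iff)
    then show ?thesis using False by (simp add: gamma_density_def)
  qed
  then have "(\<integral>\<^sup>+v. ennreal (v * gamma_density a (v * r) * gamma_density b v) \<partial>lborel)
      = (\<integral>\<^sup>+v. ennreal C * ennreal (gamma_density (a + b) ((1 + r) * v)) \<partial>lborel)"
    using C by (simp add: ennreal_mult')
  also have "\<dots> = ennreal C * (\<integral>\<^sup>+v. gamma_density (a + b) ((1 + r) * v) \<partial>lborel)"
    by (rule nn_integral_cmult) measurable
  also have "(\<integral>\<^sup>+v. gamma_density (a + b) ((1 + r) * v) \<partial>lborel) = ennreal (1 / (1 + r))"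
  proof -
    have "1 = ennreal (1 + r) * (\<integral>\<^sup>+v. gamma_density (a + b) ((1 + r) * v) \<partial>lborel)"
      using nn_integral_real_affine [of "gamma_density (a + b)" "1 + r" 0] a b r
      by (simp add: nn_integral_gamma_density)
    then have "ennreal (1 / (1 + r)) = ennreal (1 / (1 + r)) * ennreal (1 + r) * (\<integral>\<^sup>+v. gamma_density (a + b) ((1 + r) * v) \<partial>lborel)"
      by (metis mult.assoc mult.right_neutral)
    also have "ennreal (1 / (1 + r)) * ennreal (1 + r) = 1"
      using r by (simp add: ennreal_mult' [symmetric] del: ennreal_plus)
    finally show ?thesis by simp
  qed
  also have "ennreal C * ennreal (1 / (1 + r)) = ennreal (beta_prime_density a b r)"
  proof -
    have "(1 + r) powr (1 - (a + b)) = (1 + r) * (1 + r) powr - (a + b)"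
      using r powr_add [of "1 + r" 1 "- (a + b)"]
      by (simp only: add_uminus_conv_diff) simp
    then have "C * (1 / (1 + r)) = beta_prime_density a b r"
      using r by (simp add: C_def beta_prime_density_def)
    then show ?thesis using C by (simp add: ennreal_mult' [symmetric])
  qed
  finally show ?thesis .
qed

text \<open>The event is integrated against the product density. For fixed \<open>v\<close> the
  numerator is written as \<open>u = v * r\<close>, and after exchanging the integrals the inner one
  is the ratio density; \<open>t \<ge> 0\<close> leaves only positive \<open>r\<close>.\<close>

lemma (in prob_space) emeasure_gamma_ratio_gt:
  assumes indep: "indep_var borel U borel V"
    and U: "distributed M lborel U (gamma_density a)"
    and V: "distributed M lborel V (gamma_density b)"
    and a: "a > 0" and b: "b > 0" and t: "t \<ge> 0"
  shows "emeasure M {\<omega> \<in> space M. U \<omega> / V \<omega> > t}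
    = (\<integral>\<^sup>+r. ennreal (beta_prime_density a b r) * indicator {t<..} r \<partial>lborel)"
proof -
  let ?S = "{z :: real \<times> real. fst z / snd z > t}"
  let ?h = "\<lambda>r v. ennreal (v * gamma_density a (v * r) * gamma_density b v) * indicator {t<..} r"
  have indep': "indep_var lborel U lborel V"
    using indep unfolding indep_var_eq by simp
  have UV: "distributed M (lborel \<Otimes>\<^sub>M lborel) (\<lambda>\<omega>. (U \<omega>, V \<omega>))
      (\<lambda>(u, v). ennreal (gamma_density a u) * ennreal (gamma_density b v))"
    by (rule distributed_joint_indep [OF _ _ U V indep']) (simp_all add: sigma_finite_lborel)
  have "{z \<in> space (borel \<Otimes>\<^sub>M borel). fst z / snd z > t} \<in> sets (borel \<Otimes>\<^sub>M (borel :: real measure))"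
    by measurable
  then have S [measurable]: "?S \<in> sets (borel \<Otimes>\<^sub>M borel)"
    by (simp add: space_pair_measure)
  have "emeasure M {\<omega> \<in> space M. U \<omega> / V \<omega> > t}
      = emeasure M ((\<lambda>\<omega>. (U \<omega>, V \<omega>)) -` ?S \<inter> space M)"
    by (intro arg_cong [where f = "emeasure M"]) auto
  also have "\<dots> = (\<integral>\<^sup>+z. (case z of (u, v) \<Rightarrow> ennreal (gamma_density a u) * ennreal (gamma_density b v))
      * indicator ?S z \<partial>(lborel \<Otimes>\<^sub>M lborel))"
    by (rule distributed_emeasure [OF UV]) (simp add: S cong: sets_pair_measure_cong)
  also have "\<dots> = (\<integral>\<^sup>+v. (\<integral>\<^sup>+u. ennreal (gamma_density a u) * ennreal (gamma_density b v)
      * indicator ?S (u, v) \<partial>lborel) \<partial>lborel)"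
    by (subst lborel_pair.nn_integral_snd [symmetric]) (auto simp: case_prod_beta')
  also have "\<dots> = (\<integral>\<^sup>+v. (\<integral>\<^sup>+r. ?h r v \<partial>lborel) \<partial>lborel)"
  proof (rule nn_integral_cong)
    fix v :: real
    show "(\<integral>\<^sup>+u. ennreal (gamma_density a u) * ennreal (gamma_density b v)
        * indicator ?S (u, v) \<partial>lborel) = (\<integral>\<^sup>+r. ?h r v \<partial>lborel)"
    \<comment> \<open>For \<open>v \<le> 0\<close> the density of \<open>V\<close> vanishes, so
      neither the convention \<open>u / 0 = 0\<close> nor a negative denominator affects the
      value.\<close>
    proof (cases "v > 0")
      case True
      then show ?thesis
        by (subst nn_integral_real_affine [of _ v 0], simp, simp,
            subst nn_integral_cmult [symmetric], simp)
          (auto intro!: nn_integral_cong simp: indicator_def ennreal_mult' gamma_density_nonneg a mult.assoc)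
    next
      case False
      then show ?thesis by (simp add: gamma_density_def)
    qed
  qed
  also have "\<dots> = (\<integral>\<^sup>+r. (\<integral>\<^sup>+v. ?h r v \<partial>lborel) \<partial>lborel)"
    by (rule lborel_pair.Fubini') measurable
  also have "\<dots> = (\<integral>\<^sup>+r. ennreal (beta_prime_density a b r) * indicator {t<..} r \<partial>lborel)"
  proof (rule nn_integral_cong)
    fix r :: real
    show "(\<integral>\<^sup>+v. ?h r v \<partial>lborel) = ennreal (beta_prime_density a b r) * indicator {t<..} r"
      using t nn_integral_gamma_density_ratio [OF a b, of r]
      by (cases "r > t") auto
  qed
  finally show ?thesis .
qed

section \<open>Tail probabilities of the F law\<close>

lemma F_density_same:
  assumes "n \<ge> 1"
  shows "F_density n n = beta_prime_density (real n / 2) (real n / 2)"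
  using assms by (auto simp: F_density_def beta_prime_density_def fun_eq_iff)

text \<open>The density is nonnegative, so the integral in \<open>Q_F\<close> can be read as a
  nonnegative integral, the form in which \<open>emeasure_gamma_ratio_gt\<close> gives the
  probability.\<close>

lemma Q_F_same:
  assumes "n \<ge> 1"
  shows "Q_F n n t
    = enn2real (\<integral>\<^sup>+r. ennreal (beta_prime_density (real n / 2) (real n / 2) r) * indicator {t<..} r \<partial>lborel)"
  unfolding Q_F_def set_lebesgue_integral_def F_density_same [OF assms]
  using assms
  by (subst integral_eq_nn_integral)
    (auto simp: beta_prime_density_nonneg ennreal_mult' ennreal_indicator mult.commute)

text \<open>The Boolean marks numerator and denominator. Dividing by \<open>s c\<close> makes every
  variable standard normal, so each sum of half squares is Gamma(\<open>n\<close>/2); the scales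
  reappear only as a factor of the threshold.\<close>

lemma (in prob_space) prob_normal_square_ratio_gt:
  fixes A :: "nat \<times> bool \<Rightarrow> 'a \<Rightarrow> real"
  assumes n: "n \<ge> 1"
    and indep: "indep_vars (\<lambda>_. borel) A ({1..n} \<times> UNIV)"
    and normal: "\<And>i c. i \<in> {1..n} \<Longrightarrow> distributed M lborel (A (i, c)) (normal_density 0 (s c))"
    and s: "\<And>c. s c > 0" and t: "t \<ge> 0"
  shows "prob {\<omega> \<in> space M. (\<Sum>i = 1..n. (A (i, True) \<omega>)\<^sup>2) / (\<Sum>i = 1..n. (A (i, False) \<omega>)\<^sup>2) > t}
    = Q_F n n (((s False)\<^sup>2 / (s True)\<^sup>2) * t)"
proof -
  define B where "B = (\<lambda>(i, c) \<omega>. (A (i, c) \<omega> / s c)\<^sup>2 / 2)"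
  have B: "indep_vars (\<lambda>_. borel) B ({1..n} \<times> UNIV)"
    using indep_vars_compose2 [OF indep, of "\<lambda>(i, c) y. (y / s c)\<^sup>2 / 2" "\<lambda>_. borel"]
    by (simp add: B_def case_prod_beta')
  have gB: "distributed M lborel (B (i, c)) (gamma_density (1 / 2))" if "i \<in> {1..n}" for i c
  proof -
    have "distributed M lborel (\<lambda>\<omega>. (A (i, c) \<omega> - 0) / s c) std_normal_density"
      using normal [OF that, of c] s normal_standard_normal_convert [of "s c" "A (i, c)" 0] by blast
    from distributed_half_square_std_normal [OF this] show ?thesis by (simp add: B_def)
  qed
  define U where "U c \<omega> = (\<Sum>i = 1..n. B (i, c) \<omega>)" for c \<omega>
  have gU: "distributed M lborel (U c) (gamma_density (real n / 2))" for c
  proof -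
    have "indep_vars (\<lambda>_. borel) (\<lambda>i. B (i, c)) {1..n}"
      using indep_vars_compose2 [OF indep_vars_restrict [OF B, of "{1..n}" "\<lambda>i. {(i, c)}"],
          of "\<lambda>i f. f (i, c)" "\<lambda>_. borel"]
      by (auto simp: disjoint_family_on_def)
    then have "distributed M lborel (\<lambda>\<omega>. \<Sum>i = 1..n. B (i, c) \<omega>) (gamma_density (\<Sum>i = 1..n. 1 / 2))"
      using n gB by (intro distributed_sum_gamma) auto
    then show ?thesis by (simp add: U_def [abs_def])
  qed
  have "indep_var borel ((\<lambda>f. \<Sum>i = 1..n. f (i, True)) \<circ> (\<lambda>\<omega>. restrict (\<lambda>k. B k \<omega>) ({1..n} \<times> {True})))
      borel ((\<lambda>f. \<Sum>i = 1..n. f (i, False)) \<circ> (\<lambda>\<omega>. restrict (\<lambda>k. B k \<omega>) ({1..n} \<times> {False})))"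
    by (intro indep_var_compose [OF indep_var_restrict [OF B]]) auto
  also have "(\<lambda>f. \<Sum>i = 1..n. f (i, True)) \<circ> (\<lambda>\<omega>. restrict (\<lambda>k. B k \<omega>) ({1..n} \<times> {True})) = U True"
    by (auto simp: U_def fun_eq_iff)
  also have "(\<lambda>f. \<Sum>i = 1..n. f (i, False)) \<circ> (\<lambda>\<omega>. restrict (\<lambda>k. B k \<omega>) ({1..n} \<times> {False})) = U False"
    by (auto simp: U_def fun_eq_iff)
  finally have U: "indep_var borel (U True) borel (U False)" .
  have sums: "(\<Sum>i = 1..n. (A (i, c) \<omega>)\<^sup>2) = 2 * (s c)\<^sup>2 * U c \<omega>" for c \<omega>
    using s [of c] by (simp add: U_def B_def sum_distrib_left power_divide)
  \<comment> \<open>This holds at every \<open>\<omega>\<close>: where the denominator is zero, both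
    quotients are 0 by convention.\<close>
  have ratio: "(\<Sum>i = 1..n. (A (i, True) \<omega>)\<^sup>2) / (\<Sum>i = 1..n. (A (i, False) \<omega>)\<^sup>2) > t
      \<longleftrightarrow> U True \<omega> / U False \<omega> > (s False)\<^sup>2 / (s True)\<^sup>2 * t" for \<omega>
  proof -
    have "(\<Sum>i = 1..n. (A (i, True) \<omega>)\<^sup>2) / (\<Sum>i = 1..n. (A (i, False) \<omega>)\<^sup>2)
        = (s True)\<^sup>2 / (s False)\<^sup>2 * (U True \<omega> / U False \<omega>)"
      by (simp only: sums) simp
    moreover have "t < (s True)\<^sup>2 / (s False)\<^sup>2 * x \<longleftrightarrow> (s False)\<^sup>2 / (s True)\<^sup>2 * t < x" for x
      using s [of True] s [of False] by (simp add: field_simps)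
    ultimately show ?thesis by (simp only:)
  qed
  show ?thesis
    unfolding ratio measure_def Q_F_same [OF n]
    using n s t by (subst emeasure_gamma_ratio_gt [OF U gU gU]) auto
qed

subsection \<open>Independence of blocks\<close>

text \<open>A product event over the pairs constrains, for each \<open>i\<close>, only
  \<open>X i\<close>. Independence across the blocks splits its probability over \<open>i\<close>,
  and independence within a block splits each factor over \<open>j\<close>.\<close>

lemma (in prob_space) indep_vars_Sigma:
  assumes fin: "finite I" "\<And>i. i \<in> I \<Longrightarrow> finite (J i)"
    and X: "indep_vars N X I"
    and f [measurable]: "\<And>i j. i \<in> I \<Longrightarrow> j \<in> J i \<Longrightarrow> f i j \<in> measurable (N i) (L (i, j))"
    and block: "\<And>i. i \<in> I \<Longrightarrow> indep_vars (\<lambda>j. L (i, j)) (\<lambda>j \<omega>. f i j (X i \<omega>)) (J i)"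
  shows "indep_vars L (\<lambda>(i, j) \<omega>. f i j (X i \<omega>)) (Sigma I J)"
proof (cases "Sigma I J = {}")
  case True
  then show ?thesis by (simp add: indep_vars_def2 indep_sets_def)
next
  case False
  then have I: "I \<noteq> {}" by auto
  have X_rv [measurable]: "X i \<in> measurable M (N i)" if "i \<in> I" for i
    using X that by (simp add: indep_vars_def2)
  have rv: "(\<lambda>\<omega>. f i j (X i \<omega>)) \<in> measurable M (L (i, j))" if "i \<in> I" "j \<in> J i" for i j
    using that by measurable
  then have rv: "(\<lambda>(i, j) \<omega>. f i j (X i \<omega>)) k \<in> measurable M (L k)" if "k \<in> Sigma I J" for k
    using that by auto
  have "\<forall>A\<in>Pi (Sigma I J) (\<lambda>k. sets (L k)).
      prob (\<Inter>k\<in>Sigma I J. (\<lambda>(i, j) \<omega>. f i j (X i \<omega>)) k -` A k \<inter> space M)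
      = (\<Prod>k\<in>Sigma I J. prob ((\<lambda>(i, j) \<omega>. f i j (X i \<omega>)) k -` A k \<inter> space M))"
  proof
    fix A assume A: "A \<in> Pi (Sigma I J) (\<lambda>k. sets (L k))"
    \<comment> \<open>The constraints on block \<open>i\<close>, merged into one event on the value
      of \<open>X i\<close>; it is measurable because \<open>J i\<close> is finite.\<close>
    define B where "B i = {x \<in> space (N i). \<forall>j\<in>J i. f i j x \<in> A (i, j)}" for i
    have B: "B i \<in> sets (N i)" if "i \<in> I" for i
      unfolding B_def
    proof (rule sets.sets_Collect_finite_All)
      fix j assume "j \<in> J i"
      then have "f i j -` A (i, j) \<inter> space (N i) \<in> sets (N i)"
        using that A by (intro measurable_sets [OF f]) auto
      also have "f i j -` A (i, j) \<inter> space (N i) = {x \<in> space (N i). f i j x \<in> A (i, j)}"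
        by auto
      finally show "{x \<in> space (N i). f i j x \<in> A (i, j)} \<in> sets (N i)" .
    qed (use that fin in simp)
    have block_prob: "prob (X i -` B i \<inter> space M)
        = (\<Prod>j\<in>J i. prob ((\<lambda>\<omega>. f i j (X i \<omega>)) -` A (i, j) \<inter> space M))" if i: "i \<in> I" for i
    proof (cases "J i = {}")
      case True
      then have "X i -` B i \<inter> space M = space M"
        using measurable_space [OF X_rv [OF i]] by (auto simp: B_def)
      then show ?thesis using True by (simp add: prob_space)
    next
      case False
      then have "X i -` B i \<inter> space M = (\<Inter>j\<in>J i. (\<lambda>\<omega>. f i j (X i \<omega>)) -` A (i, j) \<inter> space M)"
        using measurable_space [OF X_rv [OF i]] by (auto simp: B_def)
      also have "prob \<dots> = (\<Prod>j\<in>J i. prob ((\<lambda>\<omega>. f i j (X i \<omega>)) -` A (i, j) \<inter> space M))"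
        using False fin A i by (intro indep_varsD_finite [OF block [OF i]]) auto
      finally show ?thesis .
    qed
    have "(\<Inter>k\<in>Sigma I J. (\<lambda>(i, j) \<omega>. f i j (X i \<omega>)) k -` A k \<inter> space M)
        = (\<Inter>i\<in>I. X i -` B i \<inter> space M)"
    proof (intro set_eqI iffI)
      fix \<omega>
      assume *: "\<omega> \<in> (\<Inter>k\<in>Sigma I J. (\<lambda>(i, j) \<omega>. f i j (X i \<omega>)) k -` A k \<inter> space M)"
      with False have "\<omega> \<in> space M" by blast
      moreover have "f i j (X i \<omega>) \<in> A (i, j)" if "i \<in> I" "j \<in> J i" for i j
        using INT_D [OF *, of "(i, j)"] that by simp
      ultimately show "\<omega> \<in> (\<Inter>i\<in>I. X i -` B i \<inter> space M)"
        using measurable_space [OF X_rv] by (simp add: B_def)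
    next
      fix \<omega>
      assume *: "\<omega> \<in> (\<Inter>i\<in>I. X i -` B i \<inter> space M)"
      then show "\<omega> \<in> (\<Inter>k\<in>Sigma I J. (\<lambda>(i, j) \<omega>. f i j (X i \<omega>)) k -` A k \<inter> space M)"
        using INT_D [OF *] by (intro INT_I) (auto simp: B_def)
    qed
    also have "prob \<dots> = (\<Prod>i\<in>I. prob (X i -` B i \<inter> space M))"
      using I fin B by (intro indep_varsD_finite [OF X]) auto
    also have "\<dots> = (\<Prod>i\<in>I. \<Prod>j\<in>J i. prob ((\<lambda>\<omega>. f i j (X i \<omega>)) -` A (i, j) \<inter> space M))"
      by (intro prod.cong refl block_prob)
    also have "\<dots> = (\<Prod>k\<in>Sigma I J. prob ((\<lambda>(i, j) \<omega>. f i j (X i \<omega>)) k -` A k \<inter> space M))"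
      using fin by (subst prod.Sigma) (auto intro!: prod.cong)
    finally show "prob (\<Inter>k\<in>Sigma I J. (\<lambda>(i, j) \<omega>. f i j (X i \<omega>)) k -` A k \<inter> space M)
      = (\<Prod>k\<in>Sigma I J. prob ((\<lambda>(i, j) \<omega>. f i j (X i \<omega>)) k -` A k \<inter> space M))" .
  qed
  then show ?thesis
    by (rule indep_vars_finite [where E = "\<lambda>k. sets (L k)", THEN iffD2, rotated -1])
      (use False fin rv in \<open>simp_all add: sets.sigma_sets_eq sets.Int_stable sets.space_closed\<close>)
qed

subsection \<open>Rotational invariance of Gaussian vectors\<close>

text \<open>Serves translations (\<open>c = 1\<close>) and reflections (\<open>c = - 1\<close>)
  alike; the Jacobian is a power of \<open>\<bar>c\<bar>\<close>, hence 1.\<close>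

lemma nn_integral_lborel_affine_isometry:
  fixes f :: "'b::euclidean_space \<Rightarrow> ennreal"
  assumes [measurable]: "f \<in> borel_measurable borel" and c: "\<bar>c\<bar> = 1"
  shows "(\<integral>\<^sup>+x. f (t + c *\<^sub>R x) \<partial>lborel) = (\<integral>\<^sup>+x. f x \<partial>lborel)"
proof -
  have "c \<noteq> 0" using c by auto
  then show ?thesis
    by (subst (2) lborel_affine [of c t])
      (simp_all add: c nn_integral_density nn_integral_distr)
qed

text \<open>Uniqueness of Haar measure: the image measure is translation invariant, hence
  proportional to Lebesgue measure, and both agree on the unit ball.\<close>
lemma nn_integral_lborel_orthogonal:
  fixes T :: "'b::euclidean_space \<Rightarrow> 'b" and f :: "'b \<Rightarrow> ennreal"
  assumes T: "orthogonal_transformation T" and f [measurable]: "f \<in> borel_measurable borel"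
  shows "(\<integral>\<^sup>+x. f (T x) \<partial>lborel) = (\<integral>\<^sup>+x. f x \<partial>lborel)"
proof -
  have lin: "linear T" using T by (rule orthogonal_transformation_linear)
  have [measurable]: "T \<in> borel_measurable borel"
    by (intro borel_measurable_continuous_onI linear_continuous_on linear_conv_bounded_linear [THEN iffD1] lin)
  \<comment> \<open>A test function with \<open>g (T x) = g x\<close> whose integral is positive and
    finite, so that it can be cancelled at the end.\<close>
  define g :: "'b \<Rightarrow> ennreal" where "g = indicator (ball 0 1)"
  have [measurable]: "g \<in> borel_measurable borel" unfolding g_def by (rule borel_measurable_indicator [OF borel_open [OF open_ball]])
  have gT: "g (T x) = g x" for x
    using T by (simp add: g_def indicator_def orthogonal_transformation_norm)
  define S where "S = inv T"
  have TS: "T (S y) = y" for y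
    unfolding S_def using orthogonal_transformation_surj [OF T] by (rule surj_f_inv_f)
  define c where "c = (\<integral>\<^sup>+y. g y \<partial>lborel)"
  have c: "c \<noteq> 0" "c \<noteq> \<infinity>"
  proof -
    have "c = emeasure lborel (ball (0 :: 'b) 1)" by (simp add: c_def g_def)
    then show "c \<noteq> 0" "c \<noteq> \<infinity>"
      using emeasure_lborel_ball_finite [of "0 :: 'b" 1] content_ball_pos [of 1 "0 :: 'b"]
      by (auto simp: measure_def)
  qed
  \<comment> \<open>The double integral of \<open>f (T x) * g (T x + y)\<close> is computed twice:
    integrating over \<open>y\<close> at once gives the left side, while shifting \<open>x\<close>
    first moves \<open>y\<close> from \<open>g\<close> into \<open>f\<close>.\<close>
  have "(\<integral>\<^sup>+x. f (T x) \<partial>lborel) * c = (\<integral>\<^sup>+x. f (T x) * (\<integral>\<^sup>+y. g y \<partial>lborel) \<partial>lborel)"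
    by (simp add: c_def nn_integral_multc)
  also have "\<dots> = (\<integral>\<^sup>+x. f (T x) * (\<integral>\<^sup>+y. g (T x + 1 *\<^sub>R y) \<partial>lborel) \<partial>lborel)"
    by (subst nn_integral_lborel_affine_isometry) auto
  also have "\<dots> = (\<integral>\<^sup>+x. (\<integral>\<^sup>+y. f (T x) * g (T x + y) \<partial>lborel) \<partial>lborel)"
    by (simp add: nn_integral_cmult)
  also have "\<dots> = (\<integral>\<^sup>+y. (\<integral>\<^sup>+x. f (T x) * g (T x + y) \<partial>lborel) \<partial>lborel)"
    by (rule lborel_pair.Fubini' [symmetric]) measurable
  also have "\<dots> = (\<integral>\<^sup>+y. (\<integral>\<^sup>+x. f (T x - y) * g (T x) \<partial>lborel) \<partial>lborel)"
  proof (rule nn_integral_cong)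
    fix y
    \<comment> \<open>The shift of \<open>x\<close> by \<open>- S y\<close> changes
      \<open>T x\<close> into \<open>T x - y\<close>, because \<open>T (S y) = y\<close>.\<close>
    have "(\<integral>\<^sup>+x. f (T (- S y + 1 *\<^sub>R x)) * g (T (- S y + 1 *\<^sub>R x) + y) \<partial>lborel)
        = (\<integral>\<^sup>+x. f (T x) * g (T x + y) \<partial>lborel)"
      by (rule nn_integral_lborel_affine_isometry) auto
    then show "(\<integral>\<^sup>+x. f (T x) * g (T x + y) \<partial>lborel) = (\<integral>\<^sup>+x. f (T x - y) * g (T x) \<partial>lborel)"
      by (simp add: linear_add [OF lin] linear_diff [OF lin] linear_neg [OF lin] TS)
  qed
  also have "\<dots> = (\<integral>\<^sup>+x. (\<integral>\<^sup>+y. f (T x - y) * g (T x) \<partial>lborel) \<partial>lborel)"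
    by (rule lborel_pair.Fubini') measurable
  \<comment> \<open>The \<open>y\<close> integral absorbs \<open>T x\<close> as a translation and
    the sign as a reflection, so \<open>T\<close> disappears.\<close>
  also have "\<dots> = (\<integral>\<^sup>+x. (\<integral>\<^sup>+y. f (T x + (- 1) *\<^sub>R y) \<partial>lborel) * g x \<partial>lborel)"
    by (simp add: nn_integral_multc gT)
  also have "\<dots> = (\<integral>\<^sup>+x. (\<integral>\<^sup>+y. f y \<partial>lborel) * g x \<partial>lborel)"
    by (subst nn_integral_lborel_affine_isometry) auto
  also have "\<dots> = (\<integral>\<^sup>+y. f y \<partial>lborel) * c"
    by (simp add: c_def nn_integral_cmult)
  finally show ?thesis
    using c by (simp add: mult.commute [of _ c] ennreal_mult_cancel_left)
qed

lemma prod_Basis_vec: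
  fixes h :: "real^'n \<Rightarrow> 'c::comm_monoid_mult"
  shows "(\<Prod>b\<in>Basis. h b) = (\<Prod>j\<in>UNIV. h (axis j 1))"
proof -
  have Basis: "(Basis :: (real^'n) set) = range (\<lambda>j. axis j 1)"
    by (auto simp: Basis_vec_def)
  show ?thesis
    unfolding Basis by (subst prod.reindex) (auto simp: inj_on_def axis_eq_axis)
qed

text \<open>The joint density of iid centred Gaussians sees the vector only through its norm, which
  is the source of rotational invariance.\<close>

lemma prod_normal_density:
  fixes v :: "real^'n"
  shows "(\<Prod>j\<in>UNIV. normal_density 0 \<sigma> (v $ j))
    = (1 / sqrt (2 * pi * \<sigma>\<^sup>2)) ^ CARD('n) * exp (- (norm v)\<^sup>2 / (2 * \<sigma>\<^sup>2))"
proof -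
  have "(norm v)\<^sup>2 = (\<Sum>j\<in>UNIV. (v $ j)\<^sup>2)"
    unfolding power2_norm_eq_inner inner_vec_def by (simp add: power2_eq_square)
  then show ?thesis
    by (simp add: normal_density_def prod_dividef exp_sum [symmetric] sum_negf sum_divide_distrib power_one_over)
qed

text \<open>Open boxes form an intersection-stable generator of the Borel sets. On a box,
  independence factors the probability and Tonelli factors the integral, into the same
  one-dimensional integrals.\<close>

lemma (in prob_space) distributed_iid_normal_vec:
  fixes X :: "'a \<Rightarrow> real^'k"
  assumes indep: "indep_vars (\<lambda>_. borel) (\<lambda>j \<omega>. X \<omega> $ j) UNIV"
    and normal: "\<And>j. distributed M lborel (\<lambda>\<omega>. X \<omega> $ j) (normal_density 0 \<sigma>)"
  shows "distributed M lborel X (\<lambda>v. ennreal (\<Prod>j\<in>UNIV. normal_density 0 \<sigma> (v $ j)))"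
    (is "distributed M lborel X ?f")
proof -
  have comp [measurable]: "(\<lambda>\<omega>. X \<omega> $ j) \<in> borel_measurable M" for j
    using distributed_measurable [OF normal] by simp
  have [measurable]: "X \<in> borel_measurable M"
    by (subst borel_measurable_euclidean_space) (auto simp: Basis_vec_def inner_axis)
  have [measurable]: "?f \<in> borel_measurable borel" by measurable
  have box_prob: "emeasure M (X -` box a b \<inter> space M) = (\<integral>\<^sup>+v. ?f v * indicator (box a b) v \<partial>lborel)" for a b
  proof -
    have "X -` box a b \<inter> space M = (\<Inter>j\<in>UNIV. (\<lambda>\<omega>. X \<omega> $ j) -` {a $ j<..<b $ j} \<inter> space M)"
      by (auto simp: mem_box_cart)
    then have "emeasure M (X -` box a b \<inter> space M)
        = ennreal (\<Prod>j\<in>UNIV. prob ((\<lambda>\<omega>. X \<omega> $ j) -` {a $ j<..<b $ j} \<inter> space M))"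
      unfolding emeasure_eq_measure using indep_varsD_finite [OF indep, of "\<lambda>j. {a $ j<..<b $ j}"] by simp
    also have "\<dots> = (\<Prod>j\<in>UNIV. emeasure M ((\<lambda>\<omega>. X \<omega> $ j) -` {a $ j<..<b $ j} \<inter> space M))"
      by (simp add: emeasure_eq_measure prod_ennreal)
    also have "\<dots> = (\<Prod>j\<in>UNIV. \<integral>\<^sup>+x. ennreal (normal_density 0 \<sigma> x) * indicator {a $ j<..<b $ j} x \<partial>lborel)"
      by (intro prod.cong refl distributed_emeasure [OF normal]) simp
    also have "\<dots> = (\<Prod>c\<in>(Basis :: (real^'k) set). \<integral>\<^sup>+x. ennreal (normal_density 0 \<sigma> x) * indicator {a \<bullet> c<..<b \<bullet> c} x \<partial>lborel)"
      by (simp add: prod_Basis_vec inner_axis)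
    also have "\<dots> = (\<integral>\<^sup>+v. (\<Prod>c\<in>Basis. ennreal (normal_density 0 \<sigma> (v \<bullet> c)) * indicator {a \<bullet> c<..<b \<bullet> c} (v \<bullet> c)) \<partial>lborel)"
      by (rule nn_integral_lborel_prod [symmetric]) auto
    also have "\<dots> = (\<integral>\<^sup>+v. ?f v * indicator (box a b) v \<partial>lborel)"
    proof (rule nn_integral_cong)
      fix v :: "real^'k"
      have "(\<Prod>j\<in>UNIV. indicator {a $ j<..<b $ j} (v $ j)) = (indicator (box a b) v :: ennreal)"
        by (auto simp: indicator_def mem_box_cart)
      then show "(\<Prod>c\<in>Basis. ennreal (normal_density 0 \<sigma> (v \<bullet> c)) * indicator {a \<bullet> c<..<b \<bullet> c} (v \<bullet> c))
          = ?f v * indicator (box a b) v"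
        by (simp add: prod_Basis_vec inner_axis prod.distrib prod_ennreal)
    qed
    finally show ?thesis .
  qed
  have "distr M lborel X = density lborel ?f"
  proof (rule measure_eqI_generator_eq [where E = "range (\<lambda>(a, b). box a b)" and \<Omega> = UNIV
        and A = "\<lambda>n. box (- (of_nat n *\<^sub>R One)) (of_nat n *\<^sub>R One)"])
    show "Int_stable (range (\<lambda>(a, b). box a b :: (real^'k) set))"
      by (auto simp: Int_stable_def box_Int_box)
    show "(\<Union>n. box (- (of_nat n *\<^sub>R One)) (of_nat n *\<^sub>R One)) = (UNIV :: (real^'k) set)"
      unfolding UN_box_eq_UNIV ..
    show "emeasure (distr M lborel X) (box (- (of_nat n *\<^sub>R One)) (of_nat n *\<^sub>R One)) \<noteq> \<infinity>" for n
      by (simp add: emeasure_distr emeasure_eq_measure)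
    show "emeasure (distr M lborel X) A = emeasure (density lborel ?f) A"
      if "A \<in> range (\<lambda>(a, b). box a b)" for A
      using that by (auto simp: box_prob emeasure_distr emeasure_density)
  qed (auto simp: borel_eq_box)
  then show ?thesis by (simp add: distributed_def)
qed

text \<open>An orthogonal map preserves both the density and Lebesgue measure, so the image of
  \<open>X\<close> under \<open>T\<close> has the law of \<open>X\<close>; independence of the
  coordinates depends on the law only.\<close>

lemma (in prob_space) indep_vars_orthogonal_normal:
  fixes X :: "'a \<Rightarrow> real^'k" and T :: "real^'k \<Rightarrow> real^'k"
  assumes indep: "indep_vars (\<lambda>_. borel) (\<lambda>j \<omega>. X \<omega> $ j) UNIV"
    and normal: "\<And>j. distributed M lborel (\<lambda>\<omega>. X \<omega> $ j) (normal_density 0 \<sigma>)"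
    and T: "orthogonal_transformation T"
  shows "indep_vars (\<lambda>_. borel) (\<lambda>j \<omega>. T (X \<omega>) $ j) UNIV"
proof -
  let ?f = "\<lambda>v :: real^'k. ennreal (\<Prod>j\<in>UNIV. normal_density 0 \<sigma> (v $ j))"
  note X = distributed_iid_normal_vec [OF indep normal]
  have [measurable]: "X \<in> borel_measurable M" using distributed_measurable [OF X] by simp
  have [measurable]: "T \<in> borel_measurable borel"
    by (intro borel_measurable_continuous_onI linear_continuous_on linear_conv_bounded_linear [THEN iffD1]
        orthogonal_transformation_linear T)
  have fT: "?f (T v) = ?f v" for v
    using T by (simp add: prod_normal_density orthogonal_transformation_norm)
  have same: "distr M borel (\<lambda>\<omega>. T (X \<omega>)) = distr M borel X"
  proof (rule measure_eqI)
    fix A assume "A \<in> sets (distr M borel (\<lambda>\<omega>. T (X \<omega>)))"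
    then have A [measurable]: "A \<in> sets borel" by simp
    have [measurable]: "T -` A \<in> sets borel"
      using measurable_sets [of T borel borel A] by simp
    have "emeasure M (X -` (T -` A) \<inter> space M) = (\<integral>\<^sup>+v. ?f v * indicator (T -` A) v \<partial>lborel)"
      by (rule distributed_emeasure [OF X]) simp
    also have "\<dots> = (\<integral>\<^sup>+v. ?f (T v) * indicator A (T v) \<partial>lborel)"
      by (simp only: fT) (simp add: indicator_def)
    also have "\<dots> = (\<integral>\<^sup>+v. ?f v * indicator A v \<partial>lborel)"
      by (rule nn_integral_lborel_orthogonal [OF T]) measurable
    also have "\<dots> = emeasure M (X -` A \<inter> space M)"
      by (rule distributed_emeasure [OF X, symmetric]) simp
    finally show "emeasure (distr M borel (\<lambda>\<omega>. T (X \<omega>))) A = emeasure (distr M borel X) A"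
      by (simp add: emeasure_distr vimage_comp [symmetric] comp_def vimage_def)
  qed simp
  have TX [measurable]: "(\<lambda>\<omega>. T (X \<omega>)) \<in> borel_measurable M" by measurable
  have transfer: "distr M N (\<lambda>\<omega>. h (T (X \<omega>))) = distr M N (\<lambda>\<omega>. h (X \<omega>))"
    if [measurable]: "h \<in> measurable borel N" for N and h :: "real^'k \<Rightarrow> 'b"
  proof -
    have "distr M N (\<lambda>\<omega>. h (T (X \<omega>))) = distr (distr M borel (\<lambda>\<omega>. T (X \<omega>))) N h"
      by (simp add: distr_distr comp_def)
    also have "\<dots> = distr M N (\<lambda>\<omega>. h (X \<omega>))"
      unfolding same by (simp add: distr_distr comp_def)
    finally show ?thesis .
  qed
  have nth: "(\<lambda>v :: real^'k. v $ j) \<in> borel_measurable borel" for j by measurable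
  have X_coord: "(\<lambda>\<omega>. X \<omega> $ j) \<in> borel_measurable M" "(\<lambda>\<omega>. T (X \<omega>) $ j) \<in> borel_measurable M" for j
    by (rule measurable_compose [OF _ nth], rule TX \<open>X \<in> borel_measurable M\<close>)+
  \<comment> \<open>Independence means that the joint law is the product of the marginals;
    \<open>transfer\<close> carries both the joint law and the marginals from \<open>X\<close> to
    its image.\<close>
  have "distr M (PiM UNIV (\<lambda>_. borel)) (\<lambda>\<omega>. \<lambda>j\<in>UNIV. T (X \<omega>) $ j)
      = distr M (PiM UNIV (\<lambda>_. borel)) (\<lambda>\<omega>. \<lambda>j\<in>UNIV. X \<omega> $ j)"
    by (rule transfer) measurable
  also have "\<dots> = PiM UNIV (\<lambda>j. distr M borel (\<lambda>\<omega>. X \<omega> $ j))"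
    using indep X_coord by (subst (asm) indep_vars_iff_distr_eq_PiM) simp_all
  also have "\<dots> = PiM UNIV (\<lambda>j. distr M borel (\<lambda>\<omega>. T (X \<omega>) $ j))"
    by (intro PiM_cong refl transfer [symmetric]) measurable
  finally show ?thesis
    using X_coord by (subst indep_vars_iff_distr_eq_PiM) simp_all
qed

text \<open>Rotating \<open>p\<close> onto a coordinate axis forces the image of \<open>q\<close> to
  vanish in that coordinate, so the two inner products read disjoint sets of independent
  coordinates.\<close>

lemma (in prob_space) indep_var_inner_orthogonal:
  fixes X :: "'a \<Rightarrow> real^'k"
  assumes indep: "indep_vars (\<lambda>_. borel) (\<lambda>j \<omega>. X \<omega> $ j) UNIV"
    and normal: "\<And>j. distributed M lborel (\<lambda>\<omega>. X \<omega> $ j) (normal_density 0 \<sigma>)"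
    and pq: "p \<bullet> q = 0"
  shows "indep_var borel (\<lambda>\<omega>. p \<bullet> X \<omega>) borel (\<lambda>\<omega>. q \<bullet> X \<omega>)"
proof -
  obtain i :: 'k where True by simp
  obtain T :: "real^'k \<Rightarrow> real^'k" where T: "orthogonal_transformation T" "T p = norm p *\<^sub>R axis i 1"
    using orthogonal_transformation_exists [of p "norm p *\<^sub>R axis i 1"] by auto
  \<comment> \<open>This is \<open>{i}\<close>, or empty when \<open>p = 0\<close>, so the
    degenerate case is covered too.\<close>
  define S where "S = {j. T p $ j \<noteq> 0}"
  have inner_T: "T v \<bullet> T w = v \<bullet> w" for v w
    using T by (simp add: orthogonal_transformation_def)
  have "norm p * T q $ i = 0"
    using inner_T [of p q] pq T by (simp add: inner_axis')
  then have Tq: "T q $ j = 0" if "j \<in> S" for j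
    using that T by (auto simp: S_def axis_def split: if_splits)
  have "indep_var borel ((\<lambda>f. \<Sum>j\<in>S. T p $ j * f j) \<circ> (\<lambda>\<omega>. restrict (\<lambda>j. T (X \<omega>) $ j) S))
      borel ((\<lambda>f. \<Sum>j\<in>-S. T q $ j * f j) \<circ> (\<lambda>\<omega>. restrict (\<lambda>j. T (X \<omega>) $ j) (- S)))"
    by (intro indep_var_compose [OF indep_var_restrict [OF indep_vars_orthogonal_normal [OF indep normal T(1)]]])
      auto
  also have "(\<lambda>f. \<Sum>j\<in>S. T p $ j * f j) \<circ> (\<lambda>\<omega>. restrict (\<lambda>j. T (X \<omega>) $ j) S) = (\<lambda>\<omega>. p \<bullet> X \<omega>)"
  proof
    fix \<omega>
    have "(\<Sum>j\<in>S. T p $ j * T (X \<omega>) $ j) = T p \<bullet> T (X \<omega>)"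
      unfolding inner_vec_def by (intro sum.mono_neutral_cong_left) (auto simp: S_def)
    then show "((\<lambda>f. \<Sum>j\<in>S. T p $ j * f j) \<circ> (\<lambda>\<omega>. restrict (\<lambda>j. T (X \<omega>) $ j) S)) \<omega> = p \<bullet> X \<omega>"
      by (simp add: inner_T)
  qed
  also have "(\<lambda>f. \<Sum>j\<in>-S. T q $ j * f j) \<circ> (\<lambda>\<omega>. restrict (\<lambda>j. T (X \<omega>) $ j) (- S)) = (\<lambda>\<omega>. q \<bullet> X \<omega>)"
  proof
    fix \<omega>
    have "(\<Sum>j\<in>-S. T q $ j * T (X \<omega>) $ j) = T q \<bullet> T (X \<omega>)"
      unfolding inner_vec_def by (intro sum.mono_neutral_cong_left) (auto simp: Tq)
    then show "((\<lambda>f. \<Sum>j\<in>-S. T q $ j * f j) \<circ> (\<lambda>\<omega>. restrict (\<lambda>j. T (X \<omega>) $ j) (- S))) \<omega> = q \<bullet> X \<omega>"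
      by (simp add: inner_T)
  qed
  finally show ?thesis .
qed

subsection \<open>Sums over device groups\<close>

text \<open>Zero coefficients are dropped, since a constant has no normal density; the positive
  variance guarantees that some coefficient remains.\<close>

lemma (in prob_space) distributed_linear_combination_normal:
  assumes "finite I" and indep: "indep_vars (\<lambda>_. borel) X I"
    and s: "\<And>i. i \<in> I \<Longrightarrow> s i > 0"
    and normal: "\<And>i. i \<in> I \<Longrightarrow> distributed M lborel (X i) (normal_density 0 (s i))"
    and pos: "(\<Sum>i\<in>I. (c i)\<^sup>2 * (s i)\<^sup>2) > 0"
  shows "distributed M lborel (\<lambda>\<omega>. \<Sum>i\<in>I. c i * X i \<omega>)
    (normal_density 0 (sqrt (\<Sum>i\<in>I. (c i)\<^sup>2 * (s i)\<^sup>2)))"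
proof -
  define J where "J = {i \<in> I. c i \<noteq> 0}"
  have var: "(\<Sum>i\<in>I. (c i)\<^sup>2 * (s i)\<^sup>2) = (\<Sum>i\<in>J. (\<bar>c i\<bar> * s i)\<^sup>2)"
    using assms(1) by (intro sum.mono_neutral_cong_right) (auto simp: J_def power_mult_distrib)
  have comb: "(\<lambda>\<omega>. \<Sum>i\<in>I. c i * X i \<omega>) = (\<lambda>\<omega>. \<Sum>i\<in>J. c i * X i \<omega>)"
    using assms(1) by (intro ext sum.mono_neutral_cong_right) (auto simp: J_def)
  have "J \<noteq> {}" using pos var by auto
  moreover have "indep_vars (\<lambda>_. borel) (\<lambda>i \<omega>. c i * X i \<omega>) J"
    using indep_vars_subset [OF indep, of J]
    by (intro indep_vars_compose2 [where Y = "\<lambda>i y. c i * y" and M' = "\<lambda>_. borel"]) (auto simp: J_def)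
  moreover have "distributed M lborel (\<lambda>\<omega>. c i * X i \<omega>) (normal_density 0 (\<bar>c i\<bar> * s i))" if "i \<in> J" for i
    using normal_density_affine [of "X i" 0 "s i" "c i" 0] normal s that by (simp add: J_def)
  ultimately show ?thesis
    unfolding var comb
    using assms(1) s sum_indep_normal [of J "\<lambda>i \<omega>. c i * X i \<omega>" "\<lambda>i. \<bar>c i\<bar> * s i" "\<lambda>_. 0"]
    by (simp add: J_def)
qed

lemma (in prob_space) indep_vars_singleton:
  assumes "random_variable (N i) (X i)"
  shows "indep_vars N X {i}"
  by (rule indep_vars_finite [where E = "\<lambda>k. sets (N k)", THEN iffD2])
    (use assms in \<open>simp_all add: sets.sigma_sets_eq sets.Int_stable sets.space_closed\<close>)

lemma (in prob_space) indep_vars_bool: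
  assumes "indep_var borel (X True) borel (X False)"
  shows "indep_vars (\<lambda>_. borel) X UNIV"
proof -
  have "indep_vars (\<lambda>_. borel) X UNIV
      \<longleftrightarrow> indep_vars (case_bool borel borel) (case_bool (X True) (X False)) UNIV"
    by (intro indep_vars_cong) (auto split: bool.split)
  then show ?thesis using assms by (simp add: indep_var_def)
qed

section \<open>The observation model and its pooled outputs\<close>

locale sensor_network = prob_space P for P :: "'a measure" +
  fixes x :: "nat \<Rightarrow> 'a \<Rightarrow> real^'k" and w :: "nat \<Rightarrow> nat \<Rightarrow> 'a \<Rightarrow> real^'n"
    and Mt Nb :: nat and \<sigma>\<^sub>x \<sigma>\<^sub>0 :: real
  assumes sx: "\<sigma>\<^sub>x > 0" and s0: "\<sigma>\<^sub>0 > 0"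
    and xdist: "\<And>n j. n \<in> {1..Nb} \<Longrightarrow> distributed P lborel (\<lambda>\<omega>. x n \<omega> $ j) (normal_density 0 \<sigma>\<^sub>x)"
    and wdist: "\<And>m n i. m \<in> {1..Mt} \<Longrightarrow> n \<in> {1..Nb} \<Longrightarrow>
      distributed P lborel (\<lambda>\<omega>. w m n \<omega> $ i) (normal_density 0 \<sigma>\<^sub>0)"
    and indep: "indep_vars (\<lambda>_. borel)
      (\<lambda>k \<omega>. case k of Inl (n, j) \<Rightarrow> x n \<omega> $ j | Inr (m, n, i) \<Rightarrow> w m n \<omega> $ i)
      (({1..Nb} \<times> (UNIV :: 'k set)) <+> ({1..Mt} \<times> {1..Nb} \<times> (UNIV :: 'n set)))"
begin

definition component :: "nat \<times> 'k + nat \<times> nat \<times> 'n \<Rightarrow> 'a \<Rightarrow> real" where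
  "component k \<omega> = (case k of Inl (n, j) \<Rightarrow> x n \<omega> $ j | Inr (m, n, i) \<Rightarrow> w m n \<omega> $ i)"

definition indices :: "(nat \<times> 'k + nat \<times> nat \<times> 'n) set" where
  "indices = ({1..Nb} \<times> UNIV) <+> ({1..Mt} \<times> {1..Nb} \<times> UNIV)"

lemma indep_component: "indep_vars (\<lambda>_. borel) component indices"
  using indep by (simp add: component_def [abs_def] indices_def)

text \<open>Total output of devices that share the row \<open>r *\<^sub>R a\<close>. The signal
  direction \<open>p\<close> is left free: it is \<open>transpose H *v a\<close> under the
  alternative and 0 under the null hypothesis.\<close>

definition pooled :: "nat set \<Rightarrow> real \<Rightarrow> real^'k \<Rightarrow> real^'n \<Rightarrow> nat \<Rightarrow> 'a \<Rightarrow> real" where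
  "pooled D r p a n \<omega> = (\<Sum>m\<in>D. r * (p \<bullet> x n \<omega> + a \<bullet> w m n \<omega>))"

text \<open>The signal is common to all devices and adds coherently, so \<open>card D\<close> enters
  its coefficients and is squared in the variance; the noises are independent and contribute one
  factor \<open>card D\<close>. The noise alone keeps the variance positive when
  \<open>p = 0\<close>.\<close>

lemma distributed_pooled:
  fixes r :: real
  assumes D: "D \<subseteq> {1..Mt}" "D \<noteq> {}" and n: "n \<in> {1..Nb}" and r: "r \<noteq> 0" and a: "norm a = 1"
  shows "distributed P lborel (pooled D r p a n)
    (normal_density 0 (sqrt (r\<^sup>2 * card D * (\<sigma>\<^sub>0\<^sup>2 + card D * \<sigma>\<^sub>x\<^sup>2 * (norm p)\<^sup>2))))"
proof -
  have fin: "finite D" using D finite_subset by blast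
  define I :: "(nat \<times> 'k + nat \<times> nat \<times> 'n) set" where "I = ({n} \<times> UNIV) <+> (D \<times> {n} \<times> UNIV)"
  define c where "c k = (case k of Inl (_, j) \<Rightarrow> r * card D * p $ j | Inr (_, _, i) \<Rightarrow> r * a $ i)"
    for k :: "nat \<times> 'k + nat \<times> nat \<times> 'n"
  define s where "s k = (case k of Inl _ \<Rightarrow> \<sigma>\<^sub>x | Inr _ \<Rightarrow> \<sigma>\<^sub>0)" for k :: "nat \<times> 'k + nat \<times> nat \<times> 'n"
  have finI: "finite I" using fin by (simp add: I_def)
  have split: "(\<Sum>k\<in>I. h k) = (\<Sum>j\<in>UNIV. h (Inl (n, j))) + (\<Sum>m\<in>D. \<Sum>i\<in>UNIV. h (Inr (m, n, i)))"
    for h :: "_ \<Rightarrow> real"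
  proof -
    have "(\<Sum>k\<in>I. h k) = (\<Sum>k\<in>{n} \<times> UNIV. h (Inl k)) + (\<Sum>k\<in>D \<times> {n} \<times> UNIV. h (Inr k))"
      unfolding I_def using fin by (subst sum.Plus) auto
    then show ?thesis by (simp add: sum.cartesian_product')
  qed
  have norm_sq: "(\<Sum>i\<in>UNIV. (v $ i)\<^sup>2) = (norm v)\<^sup>2" for v :: "real^'b::finite"
    unfolding power2_norm_eq_inner inner_vec_def by (simp add: power2_eq_square)
  have var: "(\<Sum>k\<in>I. (c k)\<^sup>2 * (s k)\<^sup>2) = r\<^sup>2 * card D * (\<sigma>\<^sub>0\<^sup>2 + card D * \<sigma>\<^sub>x\<^sup>2 * (norm p)\<^sup>2)"
  proof -
    have "(\<Sum>k\<in>I. (c k)\<^sup>2 * (s k)\<^sup>2)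
        = (r * card D)\<^sup>2 * \<sigma>\<^sub>x\<^sup>2 * (\<Sum>j\<in>UNIV. (p $ j)\<^sup>2) + card D * (r\<^sup>2 * \<sigma>\<^sub>0\<^sup>2 * (\<Sum>i\<in>UNIV. (a $ i)\<^sup>2))"
      by (simp add: split c_def s_def power_mult_distrib sum_distrib_left mult_ac)
    also have "\<dots> = r\<^sup>2 * card D * (\<sigma>\<^sub>0\<^sup>2 + card D * \<sigma>\<^sub>x\<^sup>2 * (norm p)\<^sup>2)"
      unfolding norm_sq a by (simp add: power2_eq_square algebra_simps)
    finally show ?thesis .
  qed
  have comb: "(\<lambda>\<omega>. \<Sum>k\<in>I. c k * component k \<omega>) = pooled D r p a n"
    by (simp add: fun_eq_iff split c_def component_def pooled_def inner_vec_def sum.distrib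
        sum_distrib_left distrib_left mult.assoc mult.left_commute)
  have "distributed P lborel (\<lambda>\<omega>. \<Sum>k\<in>I. c k * component k \<omega>) (normal_density 0 (sqrt (\<Sum>k\<in>I. (c k)\<^sup>2 * (s k)\<^sup>2)))"
  proof (rule distributed_linear_combination_normal [OF finI])
    show "indep_vars (\<lambda>_. borel) component I"
      using D n by (intro indep_vars_subset [OF indep_component]) (auto simp: I_def indices_def)
    show "s k > 0" for k using sx s0 by (simp add: s_def split: sum.split)
    show "distributed P lborel (component k) (normal_density 0 (s k))" if "k \<in> I" for k
      using that D n xdist wdist by (auto simp: I_def s_def component_def [abs_def])
    have "card D > 0" using fin D by (simp add: card_gt_0_iff)
    then show "(\<Sum>k\<in>I. (c k)\<^sup>2 * (s k)\<^sup>2) > 0"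
      unfolding var using r s0 by (intro mult_pos_pos add_pos_nonneg) auto
  qed
  then show ?thesis unfolding var comb .
qed

text \<open>The signal vectors \<open>x n\<close> and noise vectors \<open>w m n\<close> are
  independent blocks. A signal block is read by both groups, but in orthogonal directions and thus
  independently; a noise block belongs to one device and enters at most one group.\<close>

lemma indep_vars_pooled:
  fixes p :: "bool \<Rightarrow> real^'k" and a :: "bool \<Rightarrow> real^'n" and D :: "bool \<Rightarrow> nat set"
  assumes pq: "p True \<bullet> p False = 0"
    and D: "\<And>c. D c \<subseteq> {1..Mt}" "D True \<inter> D False = {}"
  shows "indep_vars (\<lambda>_. borel) (\<lambda>(n, c). pooled (D c) r (p c) (a c) n) ({1..Nb} \<times> UNIV)"
proof -
  \<comment> \<open>\<open>L\<close> labels the blocks, \<open>K l\<close> lists the scalar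
    components of a block, \<open>J l\<close> the groups assigned to it, and \<open>f l c\<close> is
    the inner product that group \<open>c\<close> takes with it.\<close>
  define L :: "(nat + nat \<times> nat) set" where "L = {1..Nb} <+> ({1..Mt} \<times> {1..Nb})"
  define K :: "nat + nat \<times> nat \<Rightarrow> (nat \<times> 'k + nat \<times> nat \<times> 'n) set"
    where "K l = (case l of Inl n \<Rightarrow> range (\<lambda>j. Inl (n, j)) | Inr (m, n) \<Rightarrow> range (\<lambda>i. Inr (m, n, i)))" for l
  \<comment> \<open>The truth value of \<open>m \<in> D True\<close> is itself the group label,
    correct for devices in \<open>D False\<close> by disjointness. A device in neither group is
    labelled \<open>False\<close>, and its noise enters no sum.\<close>
  define J :: "nat + nat \<times> nat \<Rightarrow> bool set"
    where "J l = (case l of Inl n \<Rightarrow> UNIV | Inr (m, n) \<Rightarrow> {m \<in> D True})" for l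
  define f :: "nat + nat \<times> nat \<Rightarrow> bool \<Rightarrow> (nat \<times> 'k + nat \<times> nat \<times> 'n \<Rightarrow> real) \<Rightarrow> real"
    where "f l c g = (case l of Inl n \<Rightarrow> (\<Sum>j\<in>UNIV. p c $ j * g (Inl (n, j)))
      | Inr (m, n) \<Rightarrow> (\<Sum>i\<in>UNIV. a c $ i * g (Inr (m, n, i))))" for l c g
  let ?X = "\<lambda>l \<omega>. restrict (\<lambda>k. component k \<omega>) (K l)"
  have f_X: "f (Inl n) c (?X (Inl n) \<omega>) = p c \<bullet> x n \<omega>"
    "f (Inr (m, n)) c (?X (Inr (m, n)) \<omega>) = a c \<bullet> w m n \<omega>" for n m c \<omega>
    by (simp_all add: f_def K_def component_def inner_vec_def)
  have X: "indep_vars (\<lambda>l. PiM (K l) (\<lambda>_. borel)) ?X L"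
    by (rule indep_vars_restrict [OF indep_component])
      (auto simp: K_def L_def indices_def disjoint_family_on_def split: sum.splits)
  have f: "f l c \<in> borel_measurable (PiM (K l) (\<lambda>_. borel))" for l c
    unfolding f_def by (cases l) (auto simp: K_def intro!: borel_measurable_sum borel_measurable_times measurable_component_singleton split: prod.split)
  have block: "indep_vars (\<lambda>_. borel) (\<lambda>c \<omega>. f l c (?X l \<omega>)) (J l)" if l: "l \<in> L" for l
  proof (cases l)
    case (Inl n)
    with l have n: "n \<in> {1..Nb}" by (auto simp: L_def)
    have "indep_vars (\<lambda>_. borel) (\<lambda>j \<omega>. x n \<omega> $ j) UNIV"
      using indep_vars_compose2 [OF indep_vars_restrict [OF indep_component, of UNIV "\<lambda>j. {Inl (n, j)}"],
          of "\<lambda>j g. g (Inl (n, j))" "\<lambda>_. borel"] n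
      by (auto simp: disjoint_family_on_def indices_def component_def Plus_def)
    then have "indep_var borel (\<lambda>\<omega>. p True \<bullet> x n \<omega>) borel (\<lambda>\<omega>. p False \<bullet> x n \<omega>)"
      using xdist n pq by (intro indep_var_inner_orthogonal)
    then have "indep_vars (\<lambda>_. borel) (\<lambda>c \<omega>. p c \<bullet> x n \<omega>) UNIV"
      by (rule indep_vars_bool)
    then show ?thesis by (simp only: Inl f_X) (simp add: J_def)
  next
    case (Inr mn)
    obtain m n where mn: "mn = (m, n)" by (cases mn)
    have "random_variable borel (\<lambda>\<omega>. f l c (?X l \<omega>))" for c
      using X l by (intro measurable_compose [OF _ f]) (simp add: indep_vars_def2)
    then show ?thesis
      by (simp add: Inr mn J_def indep_vars_singleton)
  qed
  have fin: "finite L" "\<And>l. finite (J l)"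
    by (auto simp: L_def)
  have V: "indep_vars (\<lambda>_. borel) (\<lambda>(l, c) \<omega>. f l c (?X l \<omega>)) (Sigma L J)"
    using indep_vars_Sigma [where f = f and L = "\<lambda>_. borel", OF fin X] f block by simp
  \<comment> \<open>The (block, group) pairs that enter the pooled sum of group \<open>c\<close> at
    time \<open>n\<close>. Both groups read \<open>x n\<close>, yet the sets are disjoint because
    the label \<open>c\<close> is part of each pair.\<close>
  define R where "R = (\<lambda>(n :: nat, c). insert (Inl n, c) ((\<lambda>m. (Inr (m, n), c)) ` D c))"
  define h where "h = (\<lambda>(n :: nat, c) (g :: _ \<Rightarrow> real). r * (card (D c) * g (Inl n, c) + (\<Sum>m\<in>D c. g (Inr (m, n), c))))"
  have R: "R k \<subseteq> Sigma L J" if "k \<in> {1..Nb} \<times> UNIV" for k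
    using that D by (fastforce simp: R_def L_def J_def)
  have disj: "disjoint_family_on R ({1..Nb} \<times> UNIV)"
    by (auto simp: disjoint_family_on_def R_def)
  have h: "h k \<in> borel_measurable (PiM (R k) (\<lambda>_. borel))" for k
    unfolding h_def
    by (cases k) (auto simp: R_def intro!: borel_measurable_sum borel_measurable_times borel_measurable_add measurable_component_singleton)
  have "indep_vars (\<lambda>_. borel) (\<lambda>k \<omega>. h k (restrict (\<lambda>lc. case lc of (l, c) \<Rightarrow> f l c (?X l \<omega>)) (R k))) ({1..Nb} \<times> UNIV)"
    using indep_vars_compose2 [OF indep_vars_restrict [OF V R disj], of h "\<lambda>_. borel"] h
    by (simp add: case_prod_beta')
  moreover have "h k (restrict (\<lambda>lc. case lc of (l, c) \<Rightarrow> f l c (?X l \<omega>)) (R k))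
      = (\<lambda>(n, c). pooled (D c) r (p c) (a c) n) k \<omega>" for k \<omega>
    by (cases k) (simp add: h_def R_def f_X pooled_def sum_distrib_left distrib_left sum.distrib)
  ultimately show ?thesis by simp
qed

text \<open>Averaging and weighting reduce the statistic to \<open>M2 / M1\<close> times the ratio
  of the sums of squared pooled outputs. This factor cancels against the group sizes in the pooled
  variances, and so does the common \<open>r\<close>.\<close>

lemma prob_test_stat:
  fixes p :: "bool \<Rightarrow> real^'k" and a :: "bool \<Rightarrow> real^'n"
  assumes M: "M1 \<ge> 1" "M2 \<ge> 1" "M1 + M2 = Mt" and Nb: "Nb \<ge> 1" and \<gamma>: "\<gamma> \<ge> 0" and r: "r \<noteq> 0"
    and a: "\<And>c. norm (a c) = 1" and pq: "p True \<bullet> p False = 0"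
  shows "prob {\<omega> \<in> space P. test_stat M1 M2 Nb
        (\<lambda>m n. r * (p (m \<le> M1) \<bullet> x n \<omega> + a (m \<le> M1) \<bullet> w m n \<omega>)) > \<gamma>}
    = Q_F Nb Nb ((\<sigma>\<^sub>0\<^sup>2 + real M2 * \<sigma>\<^sub>x\<^sup>2 * (norm (p False))\<^sup>2)
        / (\<sigma>\<^sub>0\<^sup>2 + real M1 * \<sigma>\<^sub>x\<^sup>2 * (norm (p True))\<^sup>2) * \<gamma>)"
proof -
  define D where "D c = (if c then {1..M1} else {M1 + 1..M1 + M2})" for c
  define A where "A = (\<lambda>(n, c). pooled (D c) r (p c) (a c) n)"
  define v where "v c = \<sigma>\<^sub>0\<^sup>2 + card (D c) * \<sigma>\<^sub>x\<^sup>2 * (norm (p c))\<^sup>2" for c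
  define s where "s c = sqrt (r\<^sup>2 * card (D c) * v c)" for c
  have card: "card (D True) = M1" "card (D False) = M2" by (simp_all add: D_def)
  have D: "D c \<subseteq> {1..Mt}" "D c \<noteq> {}" "D True \<inter> D False = {}" for c
    using M by (auto simp: D_def)
  have v: "v c > 0" for c
    unfolding v_def using s0 by (intro add_pos_nonneg) auto
  have cardpos: "card (D c) > 0" for c using M by (simp add: D_def)
  have s: "s c > 0" "(s c)\<^sup>2 = r\<^sup>2 * card (D c) * v c" for c
    using v [of c] cardpos [of c] r by (simp_all add: s_def)
  have indep_A: "indep_vars (\<lambda>_. borel) A ({1..Nb} \<times> UNIV)"
    unfolding A_def using pq D by (intro indep_vars_pooled) auto
  have normal: "distributed P lborel (A (n, c)) (normal_density 0 (s c))" if "n \<in> {1..Nb}" for n c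
    using distributed_pooled [OF D(1) D(2) that r a] by (simp add: A_def s_def v_def)
  have stat: "test_stat M1 M2 Nb (\<lambda>m n. r * (p (m \<le> M1) \<bullet> x n \<omega> + a (m \<le> M1) \<bullet> w m n \<omega>))
      = real M2 / real M1 * ((\<Sum>n = 1..Nb. (A (n, True) \<omega>)\<^sup>2) / (\<Sum>n = 1..Nb. (A (n, False) \<omega>)\<^sup>2))" for \<omega>
  proof -
    have "(\<Sum>m = 1..M1. r * (p (m \<le> M1) \<bullet> x n \<omega> + a (m \<le> M1) \<bullet> w m n \<omega>)) = A (n, True) \<omega>" for n
      by (simp add: A_def pooled_def D_def)
    moreover have "(\<Sum>m = M1 + 1..M1 + M2. r * (p (m \<le> M1) \<bullet> x n \<omega> + a (m \<le> M1) \<bullet> w m n \<omega>)) = A (n, False) \<omega>" for n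
      by (simp add: A_def pooled_def D_def)
    moreover have "(\<Sum>n = 1..Nb. \<bar>1 / real k * A (n, c) \<omega>\<bar>\<^sup>2) = (1 / real k)\<^sup>2 * (\<Sum>n = 1..Nb. (A (n, c) \<omega>)\<^sup>2)" for k c
      by (simp only: power2_abs power_mult_distrib sum_distrib_left)
    ultimately show ?thesis
      using M unfolding test_stat_def Let_def
      by (simp only:) (simp add: power2_eq_square)
  qed
  have threshold: "real M2 / real M1 * q > \<gamma> \<longleftrightarrow> q > real M1 / real M2 * \<gamma>" for q
    using M by (simp add: field_simps)
  have scale: "(s False)\<^sup>2 / (s True)\<^sup>2 * (real M1 / real M2 * \<gamma>) = v False / v True * \<gamma>"
    using r M v [of True] by (simp add: s card)
  have "prob {\<omega> \<in> space P. (\<Sum>n = 1..Nb. (A (n, True) \<omega>)\<^sup>2) / (\<Sum>n = 1..Nb. (A (n, False) \<omega>)\<^sup>2) > real M1 / real M2 * \<gamma>}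
      = Q_F Nb Nb ((s False)\<^sup>2 / (s True)\<^sup>2 * (real M1 / real M2 * \<gamma>))"
    using \<gamma> by (intro prob_normal_square_ratio_gt Nb indep_A normal s) auto
  then show ?thesis
    unfolding stat threshold scale by (simp add: v_def card)
qed

end

section \<open>Both hypotheses as instances of the observation model\<close>

theorem theorem4:
  fixes H :: "real^'k^'n"
    and u :: "nat \<Rightarrow> real^'n" and \<rho> :: "nat \<Rightarrow> real"
    and M1 M2 Nb :: nat and \<sigma>\<^sub>x \<sigma>\<^sub>0 \<gamma> :: real
    and P :: "'a measure"
    and x :: "nat \<Rightarrow> 'a \<Rightarrow> real^'k"
    and w :: "nat \<Rightarrow> nat \<Rightarrow> 'a \<Rightarrow> real^'n"
  assumes NK: "CARD('k) \<le> CARD('n)"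
    and rankH: "rank H = CARD('k)"
    and orth: "\<forall>i\<in>{1..CARD('n)}. \<forall>j\<in>{1..CARD('n)}. u i \<bullet> u j = (if i = j then 1 else 0)"
    and eig: "\<forall>i\<in>{1..CARD('n)}. (H ** transpose H) *v u i = (\<rho> i)^2 *\<^sub>R u i"
    and ord: "\<forall>i\<in>{1..<CARD('n)}. (\<rho> (i + 1))^2 \<le> (\<rho> i)^2"
    and gap: "(\<rho> 1)^2 > (\<rho> CARD('n))^2"
    and M1: "M1 \<ge> 1" and M2: "M2 \<ge> 1" and Nb: "Nb \<ge> 1"
    and sx: "\<sigma>\<^sub>x > 0" and s0: "\<sigma>\<^sub>0 > 0" and gam: "\<gamma> > 0"
    and P: "prob_space P"
    and xdist: "\<forall>n\<in>{1..Nb}. \<forall>j. distributed P lborel (\<lambda>\<omega>. x n \<omega> $ j) (normal_density 0 \<sigma>\<^sub>x)"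
    and wdist: "\<forall>m\<in>{1..M1 + M2}. \<forall>n\<in>{1..Nb}. \<forall>i.
                   distributed P lborel (\<lambda>\<omega>. w m n \<omega> $ i) (normal_density 0 \<sigma>\<^sub>0)"
    and indep: "prob_space.indep_vars P (\<lambda>_. borel)
        (\<lambda>k \<omega>. case k of Inl (n, j) \<Rightarrow> x n \<omega> $ j | Inr (m, n, i) \<Rightarrow> w m n \<omega> $ i)
        (({1..Nb} \<times> (UNIV :: 'k set)) <+> ({1..M1 + M2} \<times> {1..Nb} \<times> (UNIV :: 'n set)))"
  shows "measure P {\<omega> \<in> space P.
            test_stat M1 M2 Nb (\<lambda>m n. Phi_row M1 M2 (u 1) (u CARD('n)) m \<bullet> w m n \<omega>) > \<gamma>}
           = Q_F Nb Nb \<gamma>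
       \<and> measure P {\<omega> \<in> space P.
            test_stat M1 M2 Nb (\<lambda>m n. Phi_row M1 M2 (u 1) (u CARD('n)) m \<bullet> (H *v x n \<omega> + w m n \<omega>)) > \<gamma>}
           = Q_F Nb Nb ((\<sigma>\<^sub>0^2 + real M2 * \<sigma>\<^sub>x^2 * (\<rho> CARD('n))^2)
                        / (\<sigma>\<^sub>0^2 + real M1 * \<sigma>\<^sub>x^2 * (\<rho> 1)^2) * \<gamma>)"
proof -
  interpret net: sensor_network P x w "M1 + M2" Nb \<sigma>\<^sub>x \<sigma>\<^sub>0
    using P sx s0 xdist wdist indep by (auto intro!: sensor_network.intro sensor_network_axioms.intro)
  define r where "r = 1 / sqrt (real (M1 + M2))"
  define a where "a c = (if c then u 1 else u CARD('n))" for c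
  define p where "p c = transpose H *v a c" for c
  have r: "r \<noteq> 0" using M1 by (simp add: r_def)
  have card_n: "CARD('n) \<ge> 1" by (simp add: Suc_le_eq)
  \<comment> \<open>The eigenvalue gap rules out dimension 1, so \<open>u 1\<close> and
    \<open>u CARD('n)\<close> carry different indices and are orthogonal.\<close>
  moreover have "CARD('n) \<noteq> 1" using gap by auto
  ultimately have a_inner: "a c \<bullet> a d = (if c = d then 1 else 0)" for c d
    using orth by (simp add: a_def)
  have eig_a: "(H ** transpose H) *v a c = (if c then (\<rho> 1)\<^sup>2 else (\<rho> CARD('n))\<^sup>2) *\<^sub>R a c" for c
    using eig card_n by (simp add: a_def)
  have p_inner: "p c \<bullet> v = a c \<bullet> (H *v v)" for c v
    by (simp add: p_def dot_lmul_matrix)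
  \<comment> \<open>Moving \<open>H\<close> across the inner product leaves
    \<open>H ** transpose H\<close> acting on an eigenvector. Orthogonality thus passes from the
    rows to \<open>p\<close>, and the squared norms of \<open>p\<close> are the eigenvalues.\<close>
  have p_p: "p c \<bullet> p d = (if d then (\<rho> 1)\<^sup>2 else (\<rho> CARD('n))\<^sup>2) * (a c \<bullet> a d)" for c d
  proof -
    have "p c \<bullet> p d = a c \<bullet> ((H ** transpose H) *v a d)"
      unfolding p_inner by (simp only: p_def matrix_vector_mul_assoc)
    then show ?thesis unfolding eig_a by simp
  qed
  have norm_a: "norm (a c) = 1" for c by (simp add: norm_eq_sqrt_inner a_inner)
  have norm_p: "(norm (p True))\<^sup>2 = (\<rho> 1)\<^sup>2" "(norm (p False))\<^sup>2 = (\<rho> CARD('n))\<^sup>2"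
    by (simp_all add: power2_norm_eq_inner p_p a_inner)
  have row: "Phi_row M1 M2 (u 1) (u CARD('n)) m = r *\<^sub>R a (m \<le> M1)" for m
    by (simp add: Phi_row_def r_def a_def)
  have H0: "Phi_row M1 M2 (u 1) (u CARD('n)) m \<bullet> w m n \<omega>
      = r * ((0 :: real^'k) \<bullet> x n \<omega> + a (m \<le> M1) \<bullet> w m n \<omega>)" for m n \<omega>
    unfolding row by simp
  have H1: "Phi_row M1 M2 (u 1) (u CARD('n)) m \<bullet> (H *v x n \<omega> + w m n \<omega>)
      = r * (p (m \<le> M1) \<bullet> x n \<omega> + a (m \<le> M1) \<bullet> w m n \<omega>)" for m n \<omega>
    unfolding row by (simp add: p_inner inner_add_right distrib_left)
  \<comment> \<open>With zero signal directions both variance terms reduce to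
    \<open>\<sigma>\<^sub>0^2\<close>, which is nonzero, so the threshold keeps the factor
    1.\<close>
  show ?thesis
    unfolding H0 H1
    using net.prob_test_stat [where a = a and p = "\<lambda>_. 0", OF M1 M2 refl Nb less_imp_le [OF gam] r norm_a]
      net.prob_test_stat [where a = a and p = p, OF M1 M2 refl Nb less_imp_le [OF gam] r norm_a] s0
    by (simp add: norm_p p_p a_inner)
qed

end
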